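(* Let $(X,d)$ be a Polish space. If its $L^2$-Wasserstein space $(\mathcal{P}_2(X),W_2)$ has a cone structure, then the element of $\mathcal{P}_2(X)$ corresponding to the vertex must be a Dirac measure.
   Context: A Polish space is a complete separable metric space. $\mathcal{P}_2(X)$ is the set of Borel probability measures on $X$ with finite second moment, endowed with the distance $$W_2(\mu,\nu)=\Bigl(\inf_{\pi\in\Pi(\mu,\nu)}\int_{X\times X}d(x,y)^2\,d\pi(x,y)\Bigr)^{1/2},$$ where $\Pi(\mu,\nu)$ is the set of Borel probability measures on $X\times X$ with marginals $\mu$ and $\nu$. The cone over a metric space $(\Sigma,\angle)$ is the quotient $C(\Sigma)=\Sigma\times[0,\infty)/\sim$, which identifies all points $(\xi,0)$, $\xi\in\Sigma$, to one point called the vertex (and makes no other identification), with the distance $$d_C((\xi,s),(\eta,t))=\sqrt{s^2+t^2-2st\cos(\min\{\angle(\xi,\eta),\pi\})}.$$ A metric space has a cone structure if it is isometric to $C(\Sigma)$ for some metric space $\Sigma$; the element corresponding to the vertex is the one matched with the vertex of $C(\Sigma)$ by the isometry. *)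

theory Defs
  imports "HOL-Probability.Probability"
begin

section \<open>The quadratic Wasserstein space\<close>

definition P2 :: "'a::polish_space measure set" where
  "P2 = {\<mu>. sets \<mu> = sets borel \<and> prob_space \<mu> \<and>
             (\<exists>x0. (\<integral>\<^sup>+ x. ennreal ((dist x x0)\<^sup>2) \<partial>\<mu>) < \<infinity>)}"

definition couplings :: "'a::polish_space measure \<Rightarrow> 'a measure \<Rightarrow> ('a \<times> 'a) measure set" where
  "couplings \<mu> \<nu> = {\<pi>. sets \<pi> = sets borel \<and> prob_space \<pi> \<and>
                      distr \<pi> borel fst = \<mu> \<and> distr \<pi> borel snd = \<nu>}"

text \<open>The infimum is taken in the extended nonnegative reals. On \<open>P2\<close> it is finite, so
  \<open>enn2real\<close> loses nothing there.\<close>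

definition W2 :: "'a::polish_space measure \<Rightarrow> 'a measure \<Rightarrow> real" where
  "W2 \<mu> \<nu> = sqrt (enn2real (INF \<pi>\<in>couplings \<mu> \<nu>. \<integral>\<^sup>+ (x, y). ennreal ((dist x y)\<^sup>2) \<partial>\<pi>))"

section \<open>The cone over a metric space\<close>

definition cone_rel :: "'b set \<Rightarrow> (('b \<times> real) \<times> ('b \<times> real)) set" where
  "cone_rel S = {(p, q). p \<in> S \<times> {0..} \<and> q \<in> S \<times> {0..} \<and> (p = q \<or> snd p = 0 \<and> snd q = 0)}"

definition cone :: "'b set \<Rightarrow> ('b \<times> real) set set" where
  "cone S = (S \<times> {0..}) // cone_rel S"

definition cone_vertex :: "'b set \<Rightarrow> ('b \<times> real) set" where
  "cone_vertex S = S \<times> {0}"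

definition cone_pre_dist :: "('b \<Rightarrow> 'b \<Rightarrow> real) \<Rightarrow> 'b \<times> real \<Rightarrow> 'b \<times> real \<Rightarrow> real" where
  "cone_pre_dist ang = (\<lambda>(\<xi>, s) (\<eta>, t). sqrt (s\<^sup>2 + t\<^sup>2 - 2 * s * t * cos (min (ang \<xi> \<eta>) pi)))"

text \<open>The value is independent of the representatives; see \<open>cone_dist_class\<close> below.\<close>

definition cone_dist ::
  "('b \<Rightarrow> 'b \<Rightarrow> real) \<Rightarrow> ('b \<times> real) set \<Rightarrow> ('b \<times> real) set \<Rightarrow> real" where
  "cone_dist ang A B = (THE r. \<exists>p\<in>A. \<exists>q\<in>B. r = cone_pre_dist ang p q)"

lemma equiv_cone_rel: "equiv (S \<times> {0..}) (cone_rel S)"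
  by (rule equivI) (auto simp: cone_rel_def refl_on_def sym_def trans_def)

lemma cone_vertex_eq_class:
  assumes "\<xi> \<in> S"
  shows "cone_vertex S = cone_rel S `` {(\<xi>, 0)}"
  using assms by (auto simp: cone_vertex_def cone_rel_def)

lemma cone_vertex_in_cone: "S \<noteq> {} \<Longrightarrow> cone_vertex S \<in> cone S"
  by (metis (no_types, lifting) SigmaI all_not_in_conv atLeast_iff cone_def cone_vertex_eq_class
      order_refl quotientI)

lemma cone_pre_dist_cong:
  assumes "(p, p') \<in> cone_rel S" "(q, q') \<in> cone_rel S"
  shows "cone_pre_dist ang p q = cone_pre_dist ang p' q'"
  using assms by (auto simp: cone_rel_def cone_pre_dist_def)

lemma cone_dist_class:
  assumes "p \<in> S \<times> {0..}" "q \<in> S \<times> {0..}"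
  shows "cone_dist ang (cone_rel S `` {p}) (cone_rel S `` {q}) = cone_pre_dist ang p q"
  unfolding cone_dist_def
proof (rule the_equality)
  have "p \<in> cone_rel S `` {p}" "q \<in> cone_rel S `` {q}"
    using assms equiv_class_self[OF equiv_cone_rel] by blast+
  then show "\<exists>p'\<in>cone_rel S `` {p}. \<exists>q'\<in>cone_rel S `` {q}.
      cone_pre_dist ang p q = cone_pre_dist ang p' q'" by blast
next
  fix r assume "\<exists>p'\<in>cone_rel S `` {p}. \<exists>q'\<in>cone_rel S `` {q}. r = cone_pre_dist ang p' q'"
  then show "r = cone_pre_dist ang p q"
    using cone_pre_dist_cong by (metis Image_singleton_iff)
qed

section \<open>Isometries and cone structures\<close>

definition isometry_betw ::
  "('a \<Rightarrow> 'b) \<Rightarrow> 'a set \<Rightarrow> ('a \<Rightarrow> 'a \<Rightarrow> real) \<Rightarrow> 'b set \<Rightarrow> ('b \<Rightarrow> 'b \<Rightarrow> real) \<Rightarrow> bool" where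
  "isometry_betw f M d N e \<longleftrightarrow> bij_betw f M N \<and> (\<forall>x\<in>M. \<forall>y\<in>M. e (f x) (f y) = d x y)"

text \<open>A cone structure on \<open>(M, d)\<close> is a metric space \<open>(S, ang)\<close> with an isometry \<open>f\<close> of
  \<open>(M, d)\<close> onto the cone over it.\<close>

definition cone_structure ::
  "'a set \<Rightarrow> ('a \<Rightarrow> 'a \<Rightarrow> real) \<Rightarrow> 'b set \<Rightarrow> ('b \<Rightarrow> 'b \<Rightarrow> real) \<Rightarrow> ('a \<Rightarrow> ('b \<times> real) set) \<Rightarrow> bool"
  where
  "cone_structure M d S ang f \<longleftrightarrow>
     Metric_space S ang \<and> isometry_betw f M d (cone S) (cone_dist ang)"

end

(* Pick x in the support of the vertex \<mu>.  If \<mu> is not the Dirac measure at x, then the ray from \<mu>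
   through that Dirac measure continues to some \<nu> twice as far away.  Bounding W2 \<mu> \<nu> by the cost of
   the product coupling, with every path going through x, forces equality in the Cauchy-Schwarz
   inequality, so the distance to x is \<mu>-almost everywhere a positive constant.  This is impossible
   because x lies in the support of \<mu>. *)

theory Submission
  imports Defs
begin

text \<open>The definition of \<open>P2\<close> grants a finite second moment about some point only.
  The triangle inequality and (a + b)^2 \<le> 2 a^2 + 2 b^2 carry it over to every \<open>x\<close>,
  since constants are integrable for a probability measure.\<close>

lemma P2_integrable_dist_square:
  assumes "\<mu> \<in> P2"
  shows "integrable \<mu> (\<lambda>y. (dist y x)\<^sup>2)"
proof -
  from assms obtain x0 where s [measurable_cong]: "sets \<mu> = sets borel" and "prob_space \<mu>"
    and fin: "(\<integral>\<^sup>+ y. ennreal ((dist y x0)\<^sup>2) \<partial>\<mu>) < \<infinity>"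
    by (auto simp: P2_def)
  interpret prob_space \<mu> by fact
  have "integrable \<mu> (\<lambda>y. (dist y x0)\<^sup>2)"
    using fin by (intro integrableI_nonneg) auto
  then have "integrable \<mu> (\<lambda>y. 2 * (dist y x0)\<^sup>2 + 2 * (dist x0 x)\<^sup>2)"
    by auto
  then show ?thesis
  proof (rule Bochner_Integration.integrable_bound)
    have "(dist y x)\<^sup>2 \<le> 2 * (dist y x0)\<^sup>2 + 2 * (dist x0 x)\<^sup>2" for y
    proof -
      have "(dist y x)\<^sup>2 \<le> (dist y x0 + dist x0 x)\<^sup>2"
        by (intro power_mono dist_triangle) auto
      also have "\<dots> \<le> 2 * (dist y x0)\<^sup>2 + 2 * (dist x0 x)\<^sup>2"
        using zero_le_power2[of "dist y x0 - dist x0 x"]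
        by (simp add: power2_sum power2_diff)
      finally show ?thesis .
    qed
    then show "AE y in \<mu>. norm ((dist y x)\<^sup>2) \<le> norm (2 * (dist y x0)\<^sup>2 + 2 * (dist x0 x)\<^sup>2)"
      by auto
  qed measurable
qed

lemma P2_integrable_dist:
  assumes "\<mu> \<in> P2"
  shows "integrable \<mu> (\<lambda>y. dist y x)"
proof -
  have s [measurable_cong]: "sets \<mu> = sets borel" and "prob_space \<mu>"
    using assms by (auto simp: P2_def)
  interpret prob_space \<mu> by fact
  show ?thesis
    by (rule square_integrable_imp_integrable[OF _ P2_integrable_dist_square[OF assms]]) measurable
qed

lemma return_in_P2: "return borel x \<in> P2"
  by (auto simp: P2_def prob_space_return nn_integral_return intro!: exI[of _ x])

text \<open>The product coupling serves twice: it shows that couplings exist, and it is the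
  competitor that bounds \<open>W2\<close> from above.\<close>

lemma pair_measure_in_couplings:
  assumes "\<mu> \<in> P2" "\<nu> \<in> P2"
  shows "\<mu> \<Otimes>\<^sub>M \<nu> \<in> couplings \<mu> \<nu>"
proof -
  have s [measurable_cong]: "sets \<mu> = sets borel" "sets \<nu> = sets borel"
    and p: "prob_space \<mu>" "prob_space \<nu>"
    using assms by (auto simp: P2_def)
  interpret \<mu>: prob_space \<mu> by fact
  interpret \<nu>: prob_space \<nu> by fact
  interpret pair_prob_space \<mu> \<nu> ..
  \<comment> \<open>By second countability, the product of the Borel sigma-algebras is the Borel
    sigma-algebra of the product space.\<close>
  have b: "sets (\<mu> \<Otimes>\<^sub>M \<nu>) = sets borel"
    unfolding sets_pair_measure_cong[OF s] by (subst borel_prod) simp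
  have "distr (\<mu> \<Otimes>\<^sub>M \<nu>) borel fst = distr (\<mu> \<Otimes>\<^sub>M \<nu>) \<mu> fst"
    by (rule distr_cong) (auto simp: s)
  also have "\<dots> = \<mu>" by (rule \<nu>.distr_pair_fst)
  finally have f: "distr (\<mu> \<Otimes>\<^sub>M \<nu>) borel fst = \<mu>" .
  have "distr (\<mu> \<Otimes>\<^sub>M \<nu>) borel snd = \<nu>"
  proof (rule measure_eqI)
    fix A assume "A \<in> sets (distr (\<mu> \<Otimes>\<^sub>M \<nu>) borel snd)"
    then have [measurable]: "A \<in> sets borel" and A: "A \<in> sets \<nu>" by (auto simp: s)
    have "emeasure (distr (\<mu> \<Otimes>\<^sub>M \<nu>) borel snd) A
        = emeasure (\<mu> \<Otimes>\<^sub>M \<nu>) (snd -` A \<inter> space (\<mu> \<Otimes>\<^sub>M \<nu>))"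
      by (rule emeasure_distr) measurable
    also have "snd -` A \<inter> space (\<mu> \<Otimes>\<^sub>M \<nu>) = space \<mu> \<times> A"
      using sets.sets_into_space[OF A] by (auto simp: space_pair_measure)
    also have "emeasure (\<mu> \<Otimes>\<^sub>M \<nu>) (space \<mu> \<times> A) = emeasure \<nu> A"
      using A by (subst \<nu>.emeasure_pair_measure_Times) (auto simp: \<mu>.emeasure_space_1)
    finally show "emeasure (distr (\<mu> \<Otimes>\<^sub>M \<nu>) borel snd) A = emeasure \<nu> A" .
  qed (simp add: s)
  with b f prob_space_axioms show ?thesis by (auto simp: couplings_def)
qed

text \<open>The second marginal forces the second coordinate to be \<open>x\<close> almost surely,
  so the cost depends on the first marginal alone and is the same for all couplings.\<close>

lemma couplings_return_cost:
  fixes \<mu> :: "'a::polish_space measure"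
  assumes "\<pi> \<in> couplings \<mu> (return borel x)"
  shows "(\<integral>\<^sup>+ (y, z). ennreal ((dist y z)\<^sup>2) \<partial>\<pi>) = (\<integral>\<^sup>+ y. ennreal ((dist y x)\<^sup>2) \<partial>\<mu>)"
proof -
  have s: "sets \<pi> = sets borel"
    and f: "distr \<pi> borel fst = \<mu>" and g: "distr \<pi> borel snd = return borel x"
    using assms by (auto simp: couplings_def)
  have s' [measurable_cong]: "sets \<pi> = sets (borel \<Otimes>\<^sub>M borel)"
    unfolding s by (subst borel_prod) simp
  have "AE z in distr \<pi> borel snd. z = x"
    unfolding g by (subst AE_return) auto
  then have ae: "AE p in \<pi>. snd p = x"
    by (subst (asm) AE_distr_iff) auto
  have "(\<integral>\<^sup>+ (y, z). ennreal ((dist y z)\<^sup>2) \<partial>\<pi>) = (\<integral>\<^sup>+ p. ennreal ((dist (fst p) x)\<^sup>2) \<partial>\<pi>)"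
    by (rule nn_integral_cong_AE) (use ae in eventually_elim, auto)
  also have "\<dots> = (\<integral>\<^sup>+ y. ennreal ((dist y x)\<^sup>2) \<partial>distr \<pi> borel fst)"
    by (subst nn_integral_distr) auto
  finally show ?thesis unfolding f .
qed

lemma W2_return_square:
  assumes "\<mu> \<in> P2"
  shows "(W2 \<mu> (return borel x))\<^sup>2 = (\<integral>y. (dist y x)\<^sup>2 \<partial>\<mu>)"
proof -
  \<comment> \<open>Over an empty set the infimum would be infinite, not the common cost.\<close>
  have "couplings \<mu> (return borel x) \<noteq> {}"
    using pair_measure_in_couplings[OF assms return_in_P2] by blast
  then have "(INF \<pi>\<in>couplings \<mu> (return borel x). \<integral>\<^sup>+ (y, z). ennreal ((dist y z)\<^sup>2) \<partial>\<pi>)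
      = (\<integral>\<^sup>+ y. ennreal ((dist y x)\<^sup>2) \<partial>\<mu>)"
    by (simp add: couplings_return_cost cong: INF_cong)
  also have "\<dots> = ennreal (\<integral>y. (dist y x)\<^sup>2 \<partial>\<mu>)"
    by (intro nn_integral_eq_integral P2_integrable_dist_square assms) auto
  finally show ?thesis by (simp add: W2_def)
qed

text \<open>The product coupling is tested against dist y z \<le> dist y x + dist z x. Independence
  turns the integral of the cross term into the product of the two mean distances.\<close>

lemma W2_square_le_through_point:
  assumes "\<mu> \<in> P2" "\<nu> \<in> P2"
  shows "(W2 \<mu> \<nu>)\<^sup>2 \<le> (\<integral>y. (dist y x)\<^sup>2 \<partial>\<mu>) + (\<integral>z. (dist z x)\<^sup>2 \<partial>\<nu>)
           + 2 * (\<integral>y. dist y x \<partial>\<mu>) * (\<integral>z. dist z x \<partial>\<nu>)"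
proof -
  have s [measurable_cong]: "sets \<mu> = sets borel" "sets \<nu> = sets borel"
    and p: "prob_space \<mu>" "prob_space \<nu>"
    using assms by (auto simp: P2_def)
  interpret \<mu>: prob_space \<mu> by fact
  interpret \<nu>: prob_space \<nu> by fact
  interpret pair_prob_space \<mu> \<nu> ..
  note [simp] = P2_integrable_dist_square[OF assms(1), of x] P2_integrable_dist_square[OF assms(2), of x]
    P2_integrable_dist[OF assms(1), of x] P2_integrable_dist[OF assms(2), of x]
  \<comment> \<open>For fixed \<open>y\<close>, this is the integral over \<open>z\<close> of the
    right-hand side of \<open>le\<close> below.\<close>
  define I where "I y = (dist y x)\<^sup>2 + (\<integral>z. (dist z x)\<^sup>2 \<partial>\<nu>) + 2 * dist y x * (\<integral>z. dist z x \<partial>\<nu>)" for y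
  have I0: "I y \<ge> 0" for y by (simp add: I_def)
  have le: "(dist y z)\<^sup>2 \<le> (dist y x)\<^sup>2 + (dist z x)\<^sup>2 + 2 * dist y x * dist z x" for y z
  proof -
    have "(dist y z)\<^sup>2 \<le> (dist y x + dist z x)\<^sup>2"
      by (intro power_mono dist_triangle2) auto
    then show ?thesis by (simp add: power2_sum)
  qed
  have "(INF \<pi>\<in>couplings \<mu> \<nu>. \<integral>\<^sup>+ (y, z). ennreal ((dist y z)\<^sup>2) \<partial>\<pi>)
      \<le> (\<integral>\<^sup>+ (y, z). ennreal ((dist y z)\<^sup>2) \<partial>(\<mu> \<Otimes>\<^sub>M \<nu>))"
    by (rule INF_lower[OF pair_measure_in_couplings[OF assms]])
  also have "\<dots> = (\<integral>\<^sup>+ y. \<integral>\<^sup>+ z. ennreal ((dist y z)\<^sup>2) \<partial>\<nu> \<partial>\<mu>)"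
    by (subst \<nu>.nn_integral_fst[symmetric]) auto
  also have "\<dots> \<le> (\<integral>\<^sup>+ y. ennreal (I y) \<partial>\<mu>)"
  proof (rule nn_integral_mono)
    fix y
    have "(\<integral>\<^sup>+ z. ennreal ((dist y z)\<^sup>2) \<partial>\<nu>)
        \<le> (\<integral>\<^sup>+ z. ennreal ((dist y x)\<^sup>2 + (dist z x)\<^sup>2 + 2 * dist y x * dist z x) \<partial>\<nu>)"
      by (intro nn_integral_mono ennreal_leI le)
    also have "\<dots> = ennreal (\<integral>z. (dist y x)\<^sup>2 + (dist z x)\<^sup>2 + 2 * dist y x * dist z x \<partial>\<nu>)"
      by (intro nn_integral_eq_integral) auto
    also have "(\<integral>z. (dist y x)\<^sup>2 + (dist z x)\<^sup>2 + 2 * dist y x * dist z x \<partial>\<nu>) = I y"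
      by (simp add: I_def \<nu>.prob_space)
    finally show "(\<integral>\<^sup>+ z. ennreal ((dist y z)\<^sup>2) \<partial>\<nu>) \<le> ennreal (I y)" .
  qed
  also have "\<dots> = ennreal (\<integral>y. I y \<partial>\<mu>)"
    using I0 by (intro nn_integral_eq_integral) (auto simp: I_def)
  finally have "enn2real (INF \<pi>\<in>couplings \<mu> \<nu>. \<integral>\<^sup>+ (y, z). ennreal ((dist y z)\<^sup>2) \<partial>\<pi>) \<le> (\<integral>y. I y \<partial>\<mu>)"
    using I0 by (intro enn2real_leI) auto
  then show ?thesis
    by (simp add: W2_def I_def \<mu>.prob_space)
qed

text \<open>The third assumption says that the variance is at most 0. It therefore vanishes, and so
  does its nonnegative integrand almost everywhere.\<close>

lemma (in prob_space) AE_eq_expectation_if_Jensen_eq: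
  fixes X :: "'a \<Rightarrow> real"
  assumes "integrable M X" "integrable M (\<lambda>y. (X y)\<^sup>2)" "expectation (\<lambda>y. (X y)\<^sup>2) \<le> (expectation X)\<^sup>2"
  shows "AE y in M. X y = expectation X"
proof -
  have "variance X = 0"
    using assms variance_eq[of X] variance_positive[of X] by simp
  moreover have "integrable M (\<lambda>y. (X y - expectation X)\<^sup>2)"
    using assms by (simp add: power2_diff)
  ultimately show ?thesis
    by (subst (asm) integral_nonneg_eq_0_iff_AE) auto
qed

text \<open>If every point had a null ball around it, the Lindelof property would cover the whole
  space by countably many null balls, contradicting total mass 1.\<close>

lemma ex_support_point:
  fixes \<mu> :: "'a::{metric_space, second_countable_topology} measure"
  assumes "prob_space \<mu>" and s: "sets \<mu> = sets borel"
  shows "\<exists>x. \<forall>e>0. \<not> (AE y in \<mu>. dist y x \<ge> e)"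
proof (rule ccontr)
  interpret prob_space \<mu> by fact
  assume "\<not> ?thesis"
  then obtain e where e: "e x > 0" "AE y in \<mu>. dist y x \<ge> e x" for x by metis
  obtain F where F: "F \<subseteq> range (\<lambda>x. ball x (e x))" "countable F"
    "\<Union>F = \<Union>(range (\<lambda>x. ball x (e x)))"
    by (rule Lindelof[of "range (\<lambda>x. ball x (e x))"]) auto
  have avoid: "AE y in \<mu>. \<forall>B\<in>F. y \<notin> B"
  proof (rule AE_ball_countable')
    fix B assume "B \<in> F"
    then obtain x where "B = ball x (e x)" using F by auto
    then show "AE y in \<mu>. y \<notin> B" using e(2)[of x] by (auto simp: dist_commute not_less)
  qed fact
  have cover: "(\<forall>B\<in>F. y \<notin> B) \<longleftrightarrow> False" for y
  proof -
    have "y \<in> ball y (e y)" using e(1)[of y] by simp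
    then have "y \<in> \<Union>F" unfolding F(3) by blast
    then show ?thesis by blast
  qed
  have "AE y in \<mu>. False" using avoid unfolding cover .
  then show False by simp
qed

theorem corollary3p5:
  fixes S :: "'b set" and ang :: "'b \<Rightarrow> 'b \<Rightarrow> real"
    and f :: "'a::polish_space measure \<Rightarrow> ('b \<times> real) set"
    and \<mu> :: "'a measure"
  assumes "cone_structure P2 W2 S ang f"
    and "\<mu> \<in> P2" and "f \<mu> = cone_vertex S"
  shows "\<exists>x::'a. \<mu> = return borel x"
proof -
  have s: "sets \<mu> = sets borel" and p: "prob_space \<mu>"
    using assms(2) by (auto simp: P2_def)
  interpret prob_space \<mu> by fact
  have ms: "Metric_space S ang" and bij: "bij_betw f P2 (cone S)"
    and iso: "\<And>\<alpha> \<beta>. \<alpha> \<in> P2 \<Longrightarrow> \<beta> \<in> P2 \<Longrightarrow> W2 \<alpha> \<beta> = cone_dist ang (f \<alpha>) (f \<beta>)"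
    using assms(1) by (auto simp: cone_structure_def isometry_betw_def)
  obtain x where x: "\<And>e. e > 0 \<Longrightarrow> \<not> (AE y in \<mu>. dist y x \<ge> e)"
    using ex_support_point[OF p s] by blast
  let ?\<delta> = "return borel x"
  have "f ?\<delta> \<in> cone S"
    using bij return_in_P2 by (auto simp: bij_betw_def)
  then obtain \<xi> r where xi: "\<xi> \<in> S" "r \<ge> 0" and f\<delta>: "f ?\<delta> = cone_rel S `` {(\<xi>, r)}"
    by (auto simp: cone_def elim!: quotientE)
  \<comment> \<open>The vertex may be represented with any direction; choosing \<open>\<xi>\<close>
    puts it on the ray of the Dirac measure.\<close>
  have f\<mu>: "f \<mu> = cone_rel S `` {(\<xi>, 0)}"
    using assms(3) cone_vertex_eq_class[OF xi(1)] by simp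
  have "\<mu> = ?\<delta>"
  proof (cases "r = 0")
    case True
    then have "f \<mu> = f ?\<delta>" by (simp add: f\<mu> f\<delta>)
    then show ?thesis
      by (rule inj_onD[OF bij_betw_imp_inj_on[OF bij] _ assms(2) return_in_P2])
  next
    case False
    with xi have r: "r > 0" by simp
    \<comment> \<open>Radius \<open>2 * r\<close> makes the Dirac measure the midpoint between
      \<open>\<mu>\<close> and the new measure \<open>\<nu>\<close>, which exists because
      \<open>f\<close> is onto the cone.\<close>
    have "cone_rel S `` {(\<xi>, 2 * r)} \<in> f ` P2"
      using xi bij by (auto simp: bij_betw_def cone_def intro!: quotientI)
    then obtain \<nu> where \<nu>: "\<nu> \<in> P2" and f\<nu>: "f \<nu> = cone_rel S `` {(\<xi>, 2 * r)}" by auto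
    have ang0: "ang \<xi> \<xi> = 0"
      by (rule Metric_space.mdist_zero[OF ms xi(1)])
    have ray: "cone_dist ang (cone_rel S `` {(\<xi>, a)}) (cone_rel S `` {(\<xi>, b)}) = \<bar>a - b\<bar>"
      if "a \<ge> 0" "b \<ge> 0" for a b
    proof -
      have "a\<^sup>2 + b\<^sup>2 - 2 * a * b = (a - b)\<^sup>2" by (simp add: power2_diff)
      then have "cone_pre_dist ang (\<xi>, a) (\<xi>, b) = \<bar>a - b\<bar>"
        by (simp add: cone_pre_dist_def ang0)
      then show ?thesis
        using cone_dist_class[of "(\<xi>, a)" S "(\<xi>, b)" ang] that xi(1) by simp
    qed
    define m where "m = (\<integral>y. dist y x \<partial>\<mu>)"
    define m' where "m' = (\<integral>y. dist y x \<partial>\<nu>)"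
    have \<mu>\<delta>: "W2 \<mu> ?\<delta> = r"
      unfolding iso[OF assms(2) return_in_P2] f\<mu> f\<delta> using ray[of 0 r] r by simp
    have \<nu>\<delta>: "W2 \<nu> ?\<delta> = r"
      unfolding iso[OF \<nu> return_in_P2] f\<nu> f\<delta> using ray[of "2 * r" r] r by simp
    have \<mu>\<nu>: "W2 \<mu> \<nu> = 2 * r"
      unfolding iso[OF assms(2) \<nu>] f\<mu> f\<nu> using ray[of 0 "2 * r"] r by simp
    have A: "(\<integral>y. (dist y x)\<^sup>2 \<partial>\<mu>) = r\<^sup>2"
      using W2_return_square[OF assms(2), of x] unfolding \<mu>\<delta> by (rule sym)
    have B: "(\<integral>y. (dist y x)\<^sup>2 \<partial>\<nu>) = r\<^sup>2"
      using W2_return_square[OF \<nu>, of x] unfolding \<nu>\<delta> by (rule sym)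
    \<comment> \<open>Both second moments equal \<open>r\<close> squared, so the bound leaves no
      slack: the means must satisfy m m' \<ge> r^2.\<close>
    have "(2 * r)\<^sup>2 \<le> r\<^sup>2 + r\<^sup>2 + 2 * m * m'"
      using W2_square_le_through_point[OF assms(2) \<nu>, of x]
      unfolding \<mu>\<nu> A B m_def m'_def .
    then have mm: "r * r \<le> m * m'" by (simp add: power2_eq_square)
    have m0: "m \<ge> 0" by (simp add: m_def)
    have "prob_space \<nu>" using \<nu> by (auto simp: P2_def)
    \<comment> \<open>The variance of the distance to \<open>x\<close> under \<open>\<nu>\<close> is
      nonnegative.\<close>
    then have "m'\<^sup>2 \<le> r\<^sup>2"
      using prob_space.variance_eq[of \<nu> "\<lambda>y. dist y x"]
        prob_space.variance_positive[of \<nu> "\<lambda>y. dist y x"]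
        P2_integrable_dist[OF \<nu>] P2_integrable_dist_square[OF \<nu>]
      by (simp add: B m'_def)
    then have "m' \<le> r" using xi(2) by (rule power2_le_imp_le)
    then have "m * m' \<le> m * r" using m0 by (rule mult_left_mono)
    with mm have "r * r \<le> m * r" by (rule order_trans)
    then have rm: "r \<le> m" using r by simp
    \<comment> \<open>This reverses Jensen's inequality for the distance to \<open>x\<close> under
      \<open>\<mu>\<close>, whose second moment is \<open>r\<close> squared; hence that distance is
      almost everywhere constant.\<close>
    then have "r\<^sup>2 \<le> m\<^sup>2" using r by (simp add: power_mono)
    then have "AE y in \<mu>. dist y x = m"
      unfolding m_def using P2_integrable_dist[OF assms(2)] P2_integrable_dist_square[OF assms(2)]
      by (intro AE_eq_expectation_if_Jensen_eq) (auto simp: A)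
    \<comment> \<open>The open ball of radius \<open>m\<close> > 0 around \<open>x\<close> would be
      null, against the choice of \<open>x\<close> in the support.\<close>
    then have "AE y in \<mu>. dist y x \<ge> m" by auto
    with x[of m] r rm show ?thesis by simp
  qed
  then show ?thesis ..
qed

end
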